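(* The number of $9$-caps of dimension $6$ in $\mathbb{Z}_2^n$ satisfies $Q_6(9,n)=\frac{35}{9}\,Q_6(7,n)$.
   Context: $\mathbb{Z}_2^n$ is the $n$-dimensional vector space over $\mathbb{Z}_2$. A quad is a set of four distinct elements $a,b,c,d$ with $a+b+c+d=\vec 0$; a cap is a subset containing no quad; a $k$-cap is a cap with $k$ elements. Over $\mathbb{Z}_2$, affine combinations are sums of an odd number of elements and $\mathrm{aff}(S)$ is the set of affine combinations of elements of $S$. The dimension of a cap $C$ is the dimension of the flat $\mathrm{aff}(C)$. $Q_r(k,n)$ denotes the number of $k$-caps in $\mathbb{Z}_2^n$ of dimension $r$ (so $Q_6(7,n)$ counts the affinely independent $7$-element subsets). *)

theory Defs
  imports Complex_Main "HOL-Library.Z2" "HOL-Library.Function_Algebras"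
begin

text \<open>
  Vectors are functions \<open>nat \<Rightarrow> bit\<close> with pointwise addition;
  \<open>Z2 n\<close> is the copy of the \<open>n\<close>-dimensional space consisting of those vectors that
  vanish outside \<open>{..<n}\<close>. This allows \<open>n\<close> to be an ordinary natural number (including 0).
\<close>

definition bscale :: "bit \<Rightarrow> (nat \<Rightarrow> bit) \<Rightarrow> nat \<Rightarrow> bit" where
  "bscale c v = (\<lambda>i. c * v i)"

global_interpretation bvec: vector_space bscale
  by unfold_locales (auto simp: bscale_def fun_eq_iff algebra_simps)

definition Z2 :: "nat \<Rightarrow> (nat \<Rightarrow> bit) set" where
  "Z2 n = {v. \<forall>i\<ge>n. v i = 0}"

definition quad :: "(nat \<Rightarrow> bit) set \<Rightarrow> bool" where
  "quad A \<longleftrightarrow> (\<exists>a b c d. A = {a, b, c, d} \<and> distinct [a, b, c, d] \<and> a + b + c + d = 0)"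

definition cap :: "nat \<Rightarrow> (nat \<Rightarrow> bit) set \<Rightarrow> bool" where
  "cap n C \<longleftrightarrow> C \<subseteq> Z2 n \<and> \<not> (\<exists>A\<subseteq>C. quad A)"

text \<open>
  An affine combination over the two-element field has coefficients 0 and 1 with sum 1, so
  it is the sum of an odd number of elements.
\<close>

definition aff :: "(nat \<Rightarrow> bit) set \<Rightarrow> (nat \<Rightarrow> bit) set" where
  "aff S = {sum (\<lambda>x. x) T | T. T \<subseteq> S \<and> finite T \<and> odd (card T)}"

text \<open>
  The dimension of a nonempty flat is that of its direction space, the linear subspace of
  differences. As for \<open>aff_dim\<close> in \<open>HOL-Analysis\<close>, the empty flat has dimension \<open>-1\<close>.
\<close>

definition flat_dim :: "(nat \<Rightarrow> bit) set \<Rightarrow> int" where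
  "flat_dim F = (if F = {} then -1 else int (bvec.dim {x - y | x y. x \<in> F \<and> y \<in> F}))"

definition cap_dim :: "(nat \<Rightarrow> bit) set \<Rightarrow> int" where
  "cap_dim C = flat_dim (aff C)"

definition Q :: "nat \<Rightarrow> nat \<Rightarrow> nat \<Rightarrow> nat" where
  "Q r k n = card {C. cap n C \<and> card C = k \<and> cap_dim C = int r}"

end

theory Submission
  imports Defs
begin

text \<open>
  Count the triples \<open>(B, x, y)\<close> such that \<open>B\<close> is an affinely independent 7-set and
  \<open>B \<union> {x, y}\<close> is a 9-cap of dimension 6. For given \<open>B\<close>, the two new points must be
  \<open>\<Sum>(B - d)\<close> and \<open>\<Sum>(B - e)\<close> with \<open>d\<close> and \<open>e\<close> disjoint 2-subsets of \<open>B\<close>: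
  smaller odd sums, or overlapping \<open>d\<close> and \<open>e\<close>, give a quad. This leaves
  \<open>21 * 10 = 210\<close> ordered pairs. Conversely, such a cap is the disjoint union of the three
  triples \<open>e \<union> {x}\<close>, \<open>d \<union> {y}\<close> and \<open>B - (d \<union> e)\<close>, which have equal sums, so
  removing two points leaves an affinely independent set exactly if they lie in different triples;
  this gives \<open>9 * 6 = 54\<close> ordered pairs. Hence \<open>54 * Q 6 9 n = 210 * Q 6 7 n\<close>.
\<close>

section \<open>Sums of sets of vectors in characteristic 2\<close>

lemma bitfun_add_self [simp]: "x + x = (0 :: nat \<Rightarrow> bit)"
  by (simp add: fun_eq_iff)

\<comment> \<open>This simp rule also unfolds sums of bit-valued functions under a binder.\<close>
declare add_bit_eq_xor [simp del]

lemma bitfun_add_left_self [simp]: "x + (x + y) = (y :: nat \<Rightarrow> bit)"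
  by (metis add.assoc add_0 bitfun_add_self)

lemma bitfun_add_cancel: "(x + z) + (y + z) = (x + y :: nat \<Rightarrow> bit)"
proof -
  have "(x + z) + (y + z) = (x + y) + (z + z)" by (simp only: ac_simps)
  then show ?thesis by (simp only: bitfun_add_self add_0_right)
qed

lemma bitfun_add_eq_iff: "x + y = z \<longleftrightarrow> x = (y + z :: nat \<Rightarrow> bit)"
  by (metis add.commute bitfun_add_left_self)

text \<open>Vectors common to both sets occur twice on the right and cancel. Together with
  \<open>even_card_sym_diff\<close>, this lets two sums be merged while the parity of the number of
  terms is tracked.\<close>

lemma sum_sym_diff:
  fixes S T :: "(nat \<Rightarrow> bit) set"
  assumes "finite S" "finite T"
  shows "\<Sum>(sym_diff S T) = \<Sum>S + \<Sum>T"
proof -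
  have S: "\<Sum>S = \<Sum>(S - T) + \<Sum>(S \<inter> T)"
    using assms by (metis add.commute sum.Int_Diff)
  have T: "\<Sum>T = \<Sum>(T - S) + \<Sum>(S \<inter> T)"
    using assms by (metis add.commute sum.Int_Diff inf_commute)
  have "\<Sum>(sym_diff S T) = \<Sum>(S - T) + \<Sum>(T - S)"
    using assms by (intro sum.union_disjoint) auto
  then show ?thesis
    unfolding S T bitfun_add_cancel .
qed

lemma card_sym_diff:
  assumes "finite S" "finite T"
  shows "card (sym_diff S T) + 2 * card (S \<inter> T) = card S + card T"
proof -
  have "card (sym_diff S T) = card (S - T) + card (T - S)"
    using assms by (intro card_Un_disjoint) auto
  moreover have "card S = card (S - T) + card (S \<inter> T)"
    using assms by (metis add.commute card_Int_Diff)
  moreover have "card T = card (T - S) + card (S \<inter> T)"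
    using assms by (metis add.commute card_Int_Diff inf_commute)
  ultimately show ?thesis by simp
qed

lemma even_card_sym_diff:
  assumes "finite S" "finite T"
  shows "even (card (sym_diff S T)) \<longleftrightarrow> even (card S + card T)"
  using card_sym_diff [OF assms] by presburger

text \<open>The copies of \<open>a\<close> cancel in pairs; one survives exactly when their number
  is odd.\<close>

lemma sum_shift:
  fixes a :: "nat \<Rightarrow> bit"
  assumes "finite T"
  shows "(\<Sum>t\<in>T. a + t) = (if even (card T) then \<Sum>T else a + \<Sum>T)"
  using assms
proof (induction T)
  case empty
  then show ?case by simp
next
  case (insert x T)
  have "a + x + (a + \<Sum>T) = x + \<Sum>T"
    using bitfun_add_cancel [of x a "\<Sum>T"] by (simp only: add.commute)
  with insert show ?case by (simp add: add.assoc)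
qed

section \<open>Affine hulls and their dimension through linear spans\<close>

lemma mem_affI: "T \<subseteq> S \<Longrightarrow> finite T \<Longrightarrow> odd (card T) \<Longrightarrow> \<Sum>T \<in> aff S"
  unfolding aff_def by auto

lemma subset_aff: "S \<subseteq> aff S"
proof
  fix x assume "x \<in> S"
  then show "x \<in> aff S"
    using mem_affI [of "{x}" S] by simp
qed

lemma aff_mono: "S \<subseteq> T \<Longrightarrow> aff S \<subseteq> aff T"
  unfolding aff_def by blast

text \<open>Toggling \<open>a\<close> and \<open>b\<close> in the set that is summed adds
  \<open>a + b\<close> to the sum and keeps the parity of its size. Symmetric differences also cover
  \<open>a = b\<close> and points already present.\<close>

lemma add_mem_aff:
  assumes "x \<in> aff S" "a \<in> S" "b \<in> S"
  shows "a + b + x \<in> aff S"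
proof -
  obtain T where T: "x = \<Sum>T" "T \<subseteq> S" "finite T" "odd (card T)"
    using assms(1) unfolding aff_def by auto
  let ?U = "sym_diff (sym_diff T {a}) {b}"
  have "\<Sum>?U = \<Sum>T + a + b"
    using T(3) by (simp add: sum_sym_diff del: Un_insert_left Un_insert_right)
  moreover have "odd (card ?U)"
    using T(3,4) by (simp add: even_card_sym_diff)
  moreover have "?U \<subseteq> S" "finite ?U"
    using T(2,3) assms(2,3) by auto
  ultimately show ?thesis
    using mem_affI [of ?U S] T(1) by (simp add: ac_simps)
qed

text \<open>Translation by a base point turns odd sums into arbitrary linear combinations, which
  makes the theory of vector spaces available for \<open>aff\<close>.\<close>

lemma mem_aff_iff_span:
  assumes "a \<in> S"
  shows "x \<in> aff S \<longleftrightarrow> a + x \<in> bvec.span ((+) a ` S)"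
proof
  assume "x \<in> aff S"
  then obtain T where T: "x = \<Sum>T" "T \<subseteq> S" "finite T" "odd (card T)"
    unfolding aff_def by auto
  have "a + x = (\<Sum>t\<in>T. a + t)"
    using T by (simp add: sum_shift)
  also have "\<dots> \<in> bvec.span ((+) a ` S)"
    using T(2) by (intro bvec.span_sum bvec.span_base) auto
  finally show "a + x \<in> bvec.span ((+) a ` S)" .
next
  have *: "a + v \<in> aff S" if "v \<in> bvec.span ((+) a ` S)" for v
    using that
  proof (induction rule: bvec.span_induct_alt)
    case base
    then show ?case using assms subset_aff by (metis add_0_right subsetD)
  next
    case (step c u v)
    then obtain b where b: "b \<in> S" "u = a + b" by auto
    have "a + b + (a + v) \<in> aff S"
      using step.IH assms b(1) by (intro add_mem_aff)
    moreover have "a + b + (a + v) = a + (u + v)"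
      unfolding b(2) by (simp only: ac_simps)
    \<comment> \<open>A scalar is 0 or 1, so the induction step either leaves \<open>v\<close> alone
      or adds \<open>u\<close>.\<close>
    ultimately show ?case
      using step.IH by (cases c) (simp_all only: bvec.scale_one bvec.scale_zero_left add_0)
  qed
  assume "a + x \<in> bvec.span ((+) a ` S)"
  then show "x \<in> aff S"
    using * [of "a + x"] by simp
qed

text \<open>After translation to a point of \<open>T\<close>, this is closure of a linear span under
  sums.\<close>

lemma aff_subset:
  assumes "S \<subseteq> aff T" "T \<noteq> {}"
  shows "aff S \<subseteq> aff T"
proof
  fix x assume "x \<in> aff S"
  then obtain U where U: "x = \<Sum>U" "U \<subseteq> S" "finite U" "odd (card U)"
    unfolding aff_def by auto
  obtain a where a: "a \<in> T" using assms(2) by auto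
  have "a + x = (\<Sum>t\<in>U. a + t)"
    using U by (simp add: sum_shift)
  also have "\<dots> \<in> bvec.span ((+) a ` T)"
  proof (rule bvec.span_sum)
    fix t assume "t \<in> U"
    then have "t \<in> aff T" using U(2) assms(1) by blast
    then show "a + t \<in> bvec.span ((+) a ` T)"
      by (simp add: mem_aff_iff_span [OF a])
  qed
  finally show "x \<in> aff T"
    using mem_aff_iff_span [OF a] by simp
qed

text \<open>The differences of points of the hull form exactly the span of the translate of
  \<open>S\<close> by \<open>a\<close>, so the dimension is a linear rank.\<close>

lemma cap_dim_eq:
  assumes "a \<in> S"
  shows "cap_dim S = int (bvec.dim ((+) a ` S))"
proof -
  have "{x - y | x y. x \<in> aff S \<and> y \<in> aff S} = bvec.span ((+) a ` S)" (is "?D = ?V")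
  proof (intro equalityI subsetI)
    fix v assume "v \<in> ?D"
    then obtain x y where xy: "v = x - y" "x \<in> aff S" "y \<in> aff S" by auto
    have "v = (a + x) - (a + y)" using xy(1) by simp
    moreover have "a + x \<in> ?V" "a + y \<in> ?V"
      using xy(2,3) by (simp_all add: mem_aff_iff_span [OF assms])
    ultimately show "v \<in> ?V"
      using bvec.span_diff by metis
  next
    fix v assume "v \<in> ?V"
    then have "a + v \<in> aff S"
      using mem_aff_iff_span [OF assms, of "a + v"] by simp
    moreover have "v = (a + v) - a" by simp
    ultimately show "v \<in> ?D" using assms subset_aff by blast
  qed
  moreover have "aff S \<noteq> {}" using assms subset_aff by auto
  ultimately show ?thesis
    by (simp add: cap_dim_def flat_dim_def bvec.dim_span)
qed

section \<open>Affine independence\<close>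

text \<open>An affine dependence has coefficients 0 and 1 with sum 0, so it amounts to a nonempty
  finite set of even size with sum zero.\<close>

definition aff_indep :: "(nat \<Rightarrow> bit) set \<Rightarrow> bool" where
  "aff_indep B \<longleftrightarrow> (\<forall>T\<subseteq>B. finite T \<longrightarrow> even (card T) \<longrightarrow> \<Sum>T = 0 \<longrightarrow> T = {})"

text \<open>The point \<open>a\<close> is translated to 0 and adds nothing to the span. The other
  \<open>card B - 1\<close> translates thus span a space of that dimension, so a basis chosen among
  them must use them all.\<close>

lemma shift_independent:
  assumes "finite B" "int (card B) = cap_dim B + 1" "a \<in> B"
  shows "bvec.independent ((+) a ` (B - {a}))" "card ((+) a ` (B - {a})) = card B - 1"
    "bvec.span ((+) a ` (B - {a})) = bvec.span ((+) a ` B)"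
proof -
  have "(+) a ` B = insert 0 ((+) a ` (B - {a}))"
    using assms(3) by force
  then show sp: "bvec.span ((+) a ` (B - {a})) = bvec.span ((+) a ` B)"
    by (simp add: bvec.span_insert_0)
  show c: "card ((+) a ` (B - {a})) = card B - 1"
    using assms by (subst card_image) (auto simp: inj_on_def)
  have "bvec.dim ((+) a ` (B - {a})) = bvec.dim ((+) a ` B)"
    by (metis sp bvec.dim_span)
  then have dim: "card ((+) a ` (B - {a})) = bvec.dim ((+) a ` (B - {a}))"
    using c assms(2) cap_dim_eq [OF assms(3)] by simp
  obtain W where W: "W \<subseteq> (+) a ` (B - {a})" "bvec.independent W"
    "card W = bvec.dim ((+) a ` (B - {a}))"
    using bvec.basis_exists [of "(+) a ` (B - {a})"] by metis
  then have "W = (+) a ` (B - {a})"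
    using dim assms(1) by (intro card_subset_eq) auto
  then show "bvec.independent ((+) a ` (B - {a}))"
    using W(2) by simp
qed

text \<open>A nonempty even set with sum zero, translated by one of its points, would give a
  vanishing sum of linearly independent vectors.\<close>

lemma aff_indep_if_card:
  assumes "finite B" "int (card B) = cap_dim B + 1"
  shows "aff_indep B"
  unfolding aff_indep_def
proof (intro allI impI, rule ccontr)
  fix T assume T: "T \<subseteq> B" "finite T" "even (card T)" "\<Sum>T = 0" "T \<noteq> {}"
  then obtain a where a: "a \<in> T" by auto
  let ?V = "(+) a ` (B - {a})" and ?U = "(+) a ` (T - {a})"
  have "T - {a} \<noteq> {}"
  proof
    assume "T - {a} = {}"
    then have "T = {a}" using a by auto
    then show False using T(3) by simp
  qed
  moreover have "\<Sum>?U = 0"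
  proof -
    have "\<Sum>?U = (\<Sum>t\<in>T - {a}. a + t)"
      by (subst sum.reindex) (auto simp: inj_on_def)
    \<comment> \<open>The added term for \<open>t = a\<close> is \<open>a + a = 0\<close>; as
      \<open>card T\<close> is even, \<open>sum_shift\<close> then applies without a leftover
      \<open>a\<close>.\<close>
    also have "\<dots> = (\<Sum>t\<in>T. a + t)"
      using T(2) a by (simp add: sum.remove)
    finally show ?thesis
      using T by (simp add: sum_shift)
  qed
  moreover have "bvec.independent ?V"
    using shift_independent [OF assms] a T(1) by blast
  ultimately show False
    using T(1,2) bvec.independentD [of ?V ?U "\<lambda>_. 1"] by auto
qed

text \<open>A point of \<open>C\<close> outside \<open>aff B\<close> would extend the basis obtained
  from \<open>B\<close> and force a larger dimension on \<open>C\<close>.\<close>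

lemma subset_aff_if_cap_dim_eq:
  assumes "finite B" "int (card B) = cap_dim B + 1" "B \<subseteq> C" "finite C" "cap_dim C = cap_dim B"
    and "B \<noteq> {}"
  shows "C \<subseteq> aff B"
proof
  fix x assume x: "x \<in> C"
  obtain a where a: "a \<in> B" using assms(6) by auto
  let ?V = "(+) a ` (B - {a})"
  note ind = shift_independent [OF assms(1,2) a]
  show "x \<in> aff B"
  proof (rule ccontr)
    assume "x \<notin> aff B"
    then have nin: "a + x \<notin> bvec.span ?V"
      using mem_aff_iff_span [OF a] ind(3) by auto
    have "bvec.independent (insert (a + x) ?V)"
      using ind(1) nin by (simp add: bvec.independent_insertI)
    moreover obtain W where W: "W \<subseteq> (+) a ` C" "bvec.independent W"
      "(+) a ` C \<subseteq> bvec.span W" "card W = bvec.dim ((+) a ` C)"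
      using bvec.basis_exists by metis
    moreover have "finite W" using W(1) assms(4) finite_surj by blast
    moreover have "insert (a + x) ?V \<subseteq> bvec.span W"
      using W(3) x assms(3) by auto
    ultimately have "card (insert (a + x) ?V) \<le> card W"
      using bvec.independent_span_bound by blast
    moreover have "a + x \<notin> ?V" using nin bvec.span_base [of "a + x" ?V] by auto
    moreover have "finite ?V" using assms(1) by simp
    ultimately have "card B - 1 < bvec.dim ((+) a ` C)"
      using ind(2) W(4) by simp
    then show False
      using cap_dim_eq [of a C] a assms(2,3,5) by auto
  qed
qed

text \<open>A linear basis chosen among the translates by \<open>a\<close> is translated back, and
  \<open>a\<close> itself is the extra point.\<close>

lemma aff_basis_exists:
  assumes "finite C" "C \<noteq> {}"
  obtains B where "B \<subseteq> C" "int (card B) = cap_dim C + 1" "cap_dim B = cap_dim C"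
proof -
  obtain a where a: "a \<in> C" using assms(2) by auto
  obtain W where W: "W \<subseteq> (+) a ` C" "bvec.independent W"
      "(+) a ` C \<subseteq> bvec.span W" "card W = bvec.dim ((+) a ` C)"
    using bvec.basis_exists by metis
  have fin: "finite W" using W(1) assms(1) finite_surj by blast
  let ?B = "insert a ((+) a ` W)"
  have "0 \<notin> W" using W(2) bvec.dependent_zero by blast
  then have "a \<notin> (+) a ` W" by auto
  then have cB: "card ?B = card W + 1"
    using fin by (simp add: card_image)
  have "(+) a ` ?B = insert 0 W"
    by (auto simp: image_image)
  then have "bvec.dim ((+) a ` ?B) = card W"
    using W(2) by (metis bvec.dim_eq_card bvec.span_insert_0)
  then have dB: "cap_dim ?B = cap_dim C"
    using cap_dim_eq [of a ?B] cap_dim_eq [OF a] W(4) by simp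
  have "?B \<subseteq> C"
    using a W(1) by auto
  then show ?thesis
    using that [of ?B] cB dB W(4) cap_dim_eq [OF a] by simp
qed

text \<open>The symmetric difference has even size and sum zero, hence is empty. Most contradictions
  below come from this: two subsets of \<open>B\<close> with the same sum and sizes of equal parity
  must coincide.\<close>

lemma aff_indep_unique:
  assumes "aff_indep B" "finite B" "S \<subseteq> B" "T \<subseteq> B" "even (card S + card T)" "\<Sum>S = \<Sum>T"
  shows "S = T"
proof -
  have fin: "finite S" "finite T" using assms(2-4) finite_subset by auto
  have "\<Sum>(sym_diff S T) = 0"
    using fin assms(6) by (simp add: sum_sym_diff)
  moreover have "even (card (sym_diff S T))"
    using fin assms(5) by (simp add: even_card_sym_diff)
  moreover have "sym_diff S T \<subseteq> B" using assms(3,4) by auto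
  ultimately have "sym_diff S T = {}"
    using assms(1) fin unfolding aff_indep_def by blast
  then show ?thesis by auto
qed

section \<open>Quads as zero sums, and finiteness of the ambient space\<close>

lemma quad_iff: "quad A \<longleftrightarrow> card A = 4 \<and> \<Sum>A = 0"
proof
  assume "quad A"
  then show "card A = 4 \<and> \<Sum>A = 0"
    unfolding quad_def by (auto simp: ac_simps)
next
  assume A: "card A = 4 \<and> \<Sum>A = 0"
  then obtain xs where xs: "set xs = A" "distinct xs" "length xs = 4"
    using finite_distinct_list [of A] card.infinite [of A] distinct_card by fastforce
  then obtain a b c d where abcd: "xs = [a, b, c, d]"
    by (auto simp: length_Suc_conv numeral_eq_Suc)
  have "\<Sum>A = a + b + c + d"
    using xs(1,2) abcd by (auto simp: ac_simps)
  then have "A = {a, b, c, d} \<and> distinct [a, b, c, d] \<and> a + b + c + d = 0"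
    using xs(1,2) abcd A by simp
  then show "quad A"
    unfolding quad_def by blast
qed

lemma sum_Diff_bit:
  fixes B :: "(nat \<Rightarrow> bit) set"
  assumes "finite B" "d \<subseteq> B"
  shows "\<Sum>(B - d) = \<Sum>B + \<Sum>d"
proof -
  have "finite d" using assms finite_subset by blast
  moreover have "sym_diff B d = B - d" using assms(2) by auto
  ultimately show ?thesis using sum_sym_diff [of B d] assms(1) by simp
qed

lemma finite_Z2: "finite (Z2 n)"
proof -
  have "(UNIV :: bit set) = {0, 1}"
    using bit_not_zero_iff by blast
  then have "finite (UNIV :: bit set)" by (metis finite.emptyI finite.insertI)
  then have "finite {v :: nat \<Rightarrow> bit. \<forall>i. (i \<in> {..<n} \<longrightarrow> v i \<in> UNIV) \<and> (i \<notin> {..<n} \<longrightarrow> v i = 0)}"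
    by (intro finite_set_of_finite_funs) auto
  then show ?thesis
    unfolding Z2_def by (rule rev_finite_subset) auto
qed

lemma aff_subset_Z2:
  assumes "S \<subseteq> Z2 n"
  shows "aff S \<subseteq> Z2 n"
proof
  fix x assume "x \<in> aff S"
  then obtain T where T: "x = \<Sum>T" "T \<subseteq> S" "finite T"
    unfolding aff_def by auto
  have "\<Sum>T \<in> Z2 n"
    using T(3) subset_trans [OF T(2) assms]
    by (induction T) (simp_all add: Z2_def)
  then show "x \<in> Z2 n" using T(1) by simp
qed

lemma cap_dim_eq_if_subset_aff:
  assumes "B \<subseteq> C" "C \<subseteq> aff B" "B \<noteq> {}"
  shows "cap_dim C = cap_dim B"
  using aff_subset [OF assms(2,3)] aff_mono [OF assms(1)] by (simp add: cap_dim_def)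

section \<open>Extending an affinely independent 7-set to a 9-cap\<close>

lemma card_disjoint_pairs:
  assumes "card B = 7"
  shows "card (SIGMA d:{d. d \<subseteq> B \<and> card d = 2}. {e. e \<subseteq> B - d \<and> card e = 2}) = 210"
proof -
  have fin: "finite B" using assms card.infinite by fastforce
  have *: "card {e. e \<subseteq> B - d \<and> card e = 2} = 10" if "d \<in> {d. d \<subseteq> B \<and> card d = 2}" for d
  proof -
    have "card (B - d) = 5"
      using that fin assms finite_subset [of d B] by (simp add: card_Diff_subset)
    then show ?thesis
      using fin n_subsets [of "B - d" 2] by (simp add: choose_two)
  qed
  have "card {d. d \<subseteq> B \<and> card d = 2} = 21"
    using fin n_subsets [of B 2] assms by (simp add: choose_two)
  then show ?thesis
    using fin * by (subst card_SigmaI) auto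
qed

text \<open>A quad contains two, one or none of the new points. Replacing these by their sums over
  \<open>B\<close> equates the sums of subsets of \<open>B\<close> with 4 and 2, 5 and 3, or 0 and 4
  elements, against uniqueness.\<close>

lemma pair_extension_cap:
  assumes B: "card B = 7" "cap_dim B = 6" "B \<subseteq> Z2 n"
    and de: "d \<subseteq> B" "e \<subseteq> B" "card d = 2" "card e = 2" "d \<inter> e = {}"
  defines "x \<equiv> \<Sum>(B - d)" and "y \<equiv> \<Sum>(B - e)"
  shows "x \<notin> B" "y \<notin> B" "x \<noteq> y" "cap n (insert x (insert y B))"
    "cap_dim (insert x (insert y B)) = 6"
proof -
  have fin: "finite B" using B(1) card.infinite by fastforce
  have ind: "aff_indep B" using B fin by (intro aff_indep_if_card) auto
  have find: "finite d" "finite e" using de fin finite_subset by auto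
  have cd: "card (B - d) = 5" "card (B - e) = 5"
    using find de B(1) by (simp_all add: card_Diff_subset)
  have cde: "card (d \<union> e) = 4"
    using card_Un_disjoint [OF find de(5)] de(3,4) by simp
  have uniq: "card S = card T"
    if "S \<subseteq> B" "T \<subseteq> B" "even (card S + card T)" "\<Sum>S = \<Sum>T" for S T
    using aff_indep_unique [OF ind fin that] by simp
  show xB: "x \<notin> B"
    using uniq [of "{x}" "B - d"] cd unfolding x_def by auto
  show yB: "y \<notin> B"
    using uniq [of "{y}" "B - e"] cd unfolding y_def by auto
  \<comment> \<open>The total of \<open>B\<close> occurs twice and cancels, so \<open>x + y\<close>
    depends on \<open>d\<close> and \<open>e\<close> only.\<close>
  have "x + y = (\<Sum>d + \<Sum>B) + (\<Sum>e + \<Sum>B)"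
    unfolding x_def y_def using sum_Diff_bit fin de by (metis add.commute)
  also have "\<dots> = \<Sum>d + \<Sum>e" by (rule bitfun_add_cancel)
  also have "\<dots> = \<Sum>(d \<union> e)" using find de(5) by (simp add: sum.union_disjoint)
  finally have xy: "x + y = \<Sum>(d \<union> e)" .
  show "x \<noteq> y"
  proof
    assume "x = y"
    then have "\<Sum>{} = \<Sum>(d \<union> e)" using xy by simp
    then show False using uniq [of "{}" "d \<union> e"] de cde by simp
  qed
  have "x \<in> aff B" "y \<in> aff B"
    unfolding x_def y_def using fin cd by (auto intro!: mem_affI)
  then have sub: "insert x (insert y B) \<subseteq> aff B"
    using subset_aff by auto
  have "B \<noteq> {}" using B(1) by auto
  then show "cap_dim (insert x (insert y B)) = 6"
    using cap_dim_eq_if_subset_aff [OF _ sub] B(2) by auto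
  show "cap n (insert x (insert y B))"
    unfolding cap_def
  proof (intro conjI notI)
    show "insert x (insert y B) \<subseteq> Z2 n"
      using sub aff_subset_Z2 [OF B(3)] by (rule subset_trans)
    assume "\<exists>A\<subseteq>insert x (insert y B). quad A"
    then obtain A where A: "A \<subseteq> insert x (insert y B)" "card A = 4" "\<Sum>A = 0"
      by (auto simp: quad_iff)
    have finA: "finite A" using A(2) by (metis card.infinite zero_neq_numeral)
    define S where "S = A - {x, y}"
    have S: "S \<subseteq> B" "finite S" "x \<notin> S" "y \<notin> S" using A(1) finA by (auto simp: S_def)
    consider "A = insert x (insert y S)" | "A = insert x S" | "A = insert y S" | "A = S"
      unfolding S_def by blast
    then show False
    proof cases
      case 1
      have c: "card S = 2" using A(2) 1 S \<open>x \<noteq> y\<close> by simp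
      have "x + y + \<Sum>S = 0" using A(3) 1 S \<open>x \<noteq> y\<close> by (simp add: add.assoc)
      then have "\<Sum>(d \<union> e) = \<Sum>S" by (simp add: xy bitfun_add_eq_iff)
      then show False using uniq [of "d \<union> e" S] S(1) de cde c by simp
    next
      case 2
      have c: "card S = 3" using A(2) 2 S by simp
      have "x + \<Sum>S = 0" using A(3) 2 S by simp
      then have "\<Sum>(B - d) = \<Sum>S" unfolding x_def by (simp add: bitfun_add_eq_iff)
      then show False using uniq [of "B - d" S] S(1) cd c by auto
    next
      case 3
      have c: "card S = 3" using A(2) 3 S by simp
      have "y + \<Sum>S = 0" using A(3) 3 S by simp
      then have "\<Sum>(B - e) = \<Sum>S" unfolding y_def by (simp add: bitfun_add_eq_iff)
      then show False using uniq [of "B - e" S] S(1) cd c by auto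
    next
      case 4
      then show False using uniq [of "{}" A] S(1) A(2,3) by simp
    qed
  qed
qed

text \<open>Write \<open>x\<close> as an odd sum over \<open>T\<close>. One term would put
  \<open>x\<close> in \<open>B\<close>, and three terms would form a quad with \<open>x\<close>. So
  \<open>T\<close> has 5 or 7 elements, and \<open>d\<close> is its complement.\<close>

lemma extension_elem:
  assumes B: "card B = 7" and x: "x \<in> aff B" "x \<notin> B" and nq: "\<And>A. A \<subseteq> insert x B \<Longrightarrow> \<not> quad A"
  obtains d where "d \<subseteq> B" "x = \<Sum>(B - d)" "card d = 0 \<or> card d = 2"
proof -
  have fin: "finite B" using B card.infinite by fastforce
  obtain T where T: "x = \<Sum>T" "T \<subseteq> B" "finite T" "odd (card T)"
    using x(1) unfolding aff_def by auto
  have "card T \<noteq> 1"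
  proof
    assume "card T = 1"
    then obtain t where "T = {t}" by (auto simp: card_1_singleton_iff)
    then show False using T x(2) by auto
  qed
  moreover have "card T \<noteq> 3"
  proof
    assume "card T = 3"
    moreover have "x \<notin> T" using x(2) T(2) by auto
    ultimately have "quad (insert x T)"
      using T(1,3) by (simp add: quad_iff)
    then show False using nq [of "insert x T"] T(2) by auto
  qed
  moreover have "card T \<le> 7" using card_mono [OF fin T(2)] B by simp
  ultimately have "card T = 5 \<or> card T = 7" using T(4) by presburger
  moreover have "card (B - T) = 7 - card T" using T B by (simp add: card_Diff_subset)
  moreover have "B - (B - T) = T" using T(2) by auto
  ultimately show ?thesis using that [of "B - T"] T(1) by auto
qed

lemma extension_pair:
  assumes B: "card B = 7" "cap_dim B = 6" and xy: "x \<notin> B" "y \<notin> B" "x \<noteq> y"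
    and C: "cap n (insert x (insert y B))" "cap_dim (insert x (insert y B)) = 6"
  obtains d e where "d \<subseteq> B" "e \<subseteq> B" "card d = 2" "card e = 2" "d \<inter> e = {}"
    "x = \<Sum>(B - d)" "y = \<Sum>(B - e)"
proof -
  have fin: "finite B" using B(1) card.infinite by fastforce
  have "B \<noteq> {}" using B(1) by auto
  then have sub: "insert x (insert y B) \<subseteq> aff B"
    using fin B C(2) by (intro subset_aff_if_cap_dim_eq) auto
  have nq: "\<not> quad A" if "A \<subseteq> insert x (insert y B)" for A
    using C(1) that unfolding cap_def by auto
  obtain d where d: "d \<subseteq> B" "x = \<Sum>(B - d)" "card d = 0 \<or> card d = 2"
  proof (rule extension_elem [OF B(1)])
    show "\<not> quad A" if "A \<subseteq> insert x B" for A using that by (intro nq) auto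
  qed (use sub xy in auto)
  obtain e where e: "e \<subseteq> B" "y = \<Sum>(B - e)" "card e = 0 \<or> card e = 2"
  proof (rule extension_elem [OF B(1)])
    show "\<not> quad A" if "A \<subseteq> insert y B" for A using that by (intro nq) auto
  qed (use sub xy in auto)
  have find: "finite d" "finite e" using d e fin finite_subset by auto
  have "x + y = (\<Sum>d + \<Sum>B) + (\<Sum>e + \<Sum>B)"
    using sum_Diff_bit fin d e by (metis add.commute)
  also have "\<dots> = \<Sum>d + \<Sum>e" by (rule bitfun_add_cancel)
  finally have sum: "x + y = \<Sum>(sym_diff d e)" using find by (simp only: sum_sym_diff)
  \<comment> \<open>Two elements here would form a quad with \<open>x\<close> and \<open>y\<close>.
    This excludes both an overlap in one point and the case that just one of \<open>d\<close>,
    \<open>e\<close> is empty; \<open>x \<noteq> y\<close> excludes \<open>d = e\<close>.\<close>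
  have ne: "card (sym_diff d e) \<noteq> 2"
  proof
    assume c: "card (sym_diff d e) = 2"
    define U where "U = sym_diff d e"
    have U: "finite U" "U \<subseteq> B" using find d e by (auto simp: U_def)
    have "card (insert x (insert y U)) = 4"
      using c U xy by (simp flip: U_def add: card_insert_if subset_iff) blast
    moreover have "\<Sum>(insert x (insert y U)) = x + y + \<Sum>U"
      using U xy by (subst sum.insert; force simp: add.assoc)+
    ultimately have "quad (insert x (insert y U))"
      using sum by (simp flip: U_def add: quad_iff)
    then show False using nq [of "insert x (insert y U)"] U(2) by auto
  qed
  have "d \<noteq> e" using d(2) e(2) xy(3) by auto
  then have "card (sym_diff d e) \<noteq> 0" using find by auto
  moreover have "card (d \<inter> e) \<le> card d" "card (d \<inter> e) \<le> card e"
    using find by (auto intro: card_mono)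
  ultimately have "card d = 2" "card e = 2" "card (d \<inter> e) = 0"
    using card_sym_diff [OF find] ne d(3) e(3) by presburger+
  then show ?thesis using that d e find by auto
qed

text \<open>The two preceding directions identify the extensions with the image of the ordered
  disjoint pairs \<open>(d, e)\<close>. The map is injective because the complements are 5-sets
  determined by their sums.\<close>

lemma card_extensions:
  assumes B: "card B = 7" "cap_dim B = 6" "B \<subseteq> Z2 n"
  shows "card {(x, y). x \<notin> B \<and> y \<notin> B \<and> x \<noteq> y \<and> cap n (insert x (insert y B)) \<and>
    cap_dim (insert x (insert y B)) = 6} = 210" (is "card ?E = _")
proof -
  let ?D = "SIGMA d:{d. d \<subseteq> B \<and> card d = 2}. {e. e \<subseteq> B - d \<and> card e = 2}"
  let ?f = "\<lambda>(d, e). (\<Sum>(B - d), \<Sum>(B - e))"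
  have fin: "finite B" using B(1) card.infinite by fastforce
  have ind: "aff_indep B" using B fin by (intro aff_indep_if_card) auto
  have uniq: "d = e" if "d \<subseteq> B" "e \<subseteq> B" "card d = 2" "card e = 2" "\<Sum>(B - d) = \<Sum>(B - e)" for d e
  proof -
    have "card (B - d) = 5" "card (B - e) = 5"
      using that fin B(1) by (simp_all add: card_Diff_subset finite_subset)
    then have "B - d = B - e"
      using that by (intro aff_indep_unique [OF ind fin]) auto
    then show ?thesis using that by blast
  qed
  have inj: "inj_on ?f ?D"
  proof (rule inj_onI; clarify)
    fix d e d' e'
    assume *: "d \<subseteq> B" "card d = 2" "e \<subseteq> B - d" "card e = 2"
      "d' \<subseteq> B" "card d' = 2" "e' \<subseteq> B - d'" "card e' = 2"
      "\<Sum>(B - d) = \<Sum>(B - d')" "\<Sum>(B - e) = \<Sum>(B - e')"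
    then have "e \<subseteq> B" "e' \<subseteq> B" by auto
    then show "d = d' \<and> e = e'" using * uniq by metis
  qed
  have "?E = ?f ` ?D"
  proof (intro equalityI subsetI)
    fix p assume "p \<in> ?E"
    then obtain x y where p: "p = (x, y)" and xy: "x \<notin> B" "y \<notin> B" "x \<noteq> y"
      "cap n (insert x (insert y B))" "cap_dim (insert x (insert y B)) = 6" by auto
    obtain d e where de: "d \<subseteq> B" "e \<subseteq> B" "card d = 2" "card e = 2" "d \<inter> e = {}"
      "x = \<Sum>(B - d)" "y = \<Sum>(B - e)"
      using extension_pair [OF B(1,2) xy] by metis
    then have "(d, e) \<in> ?D" by auto
    then show "p \<in> ?f ` ?D"
      unfolding p de(6,7) by (rule rev_image_eqI) simp
  next
    fix p assume "p \<in> ?f ` ?D"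
    then obtain d e where de: "d \<subseteq> B" "card d = 2" "e \<subseteq> B - d" "card e = 2"
      and p: "p = (\<Sum>(B - d), \<Sum>(B - e))" by auto
    then have "e \<subseteq> B" "d \<inter> e = {}" by auto
    from pair_extension_cap [OF B de(1) this(1) de(2,4) this(2)]
    show "p \<in> ?E" unfolding p by simp
  qed
  then show ?thesis
    using card_disjoint_pairs [OF B(1)] card_image [OF inj] by simp
qed

section \<open>Triples in a 9-cap and removal of two points\<close>

text \<open>This describes the cap without a chosen basis. The union of any two of the triples has
  six elements and sum zero, so it is an affine dependence.\<close>

definition equal_sum_triples where
  "equal_sum_triples U V W \<longleftrightarrow> card U = 3 \<and> card V = 3 \<and> card W = 3 \<and>
    U \<inter> V = {} \<and> U \<inter> W = {} \<and> V \<inter> W = {} \<and> \<Sum>U = \<Sum>V \<and> \<Sum>V = (\<Sum>W :: nat \<Rightarrow> bit)"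

lemma cap_triples:
  assumes C: "cap n C" "card C = 9" "cap_dim C = 6"
  obtains U V W where "C = U \<union> V \<union> W" "equal_sum_triples U V W"
proof -
  have finC: "finite C" using C(2) card.infinite by fastforce
  have "C \<noteq> {}" using C(2) by auto
  then obtain B where B: "B \<subseteq> C" "card B = 7" "cap_dim B = 6"
    using aff_basis_exists [OF finC] C(3) by force
  have fin: "finite B" using B(1) finC finite_subset by auto
  have "card (C - B) = 2" using B fin C(2) by (simp add: card_Diff_subset)
  then obtain x y where xy: "C - B = {x, y}" "x \<noteq> y" by (auto simp: card_2_iff)
  then have Ceq: "C = insert x (insert y B)" and nin: "x \<notin> B" "y \<notin> B" using B(1) by auto
  obtain d e where de: "d \<subseteq> B" "e \<subseteq> B" "card d = 2" "card e = 2" "d \<inter> e = {}"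
      "x = \<Sum>(B - d)" "y = \<Sum>(B - e)"
    using extension_pair [OF B(2,3) nin xy(2)] C Ceq by metis
  have find: "finite d" "finite e" using de fin finite_subset by auto
  have nin2: "x \<notin> d" "x \<notin> e" "y \<notin> d" "y \<notin> e" using nin de by auto
  \<comment> \<open>The pairing is crossed: \<open>x\<close> omits \<open>d\<close> from its sum and
    is therefore joined with \<open>e\<close>, and \<open>y\<close> with \<open>d\<close>. All three
    triples then have the sum of the totals of \<open>B\<close>, \<open>d\<close> and
    \<open>e\<close>.\<close>
  have "\<Sum>(insert x e) = \<Sum>B + \<Sum>d + \<Sum>e"
    using nin2 find de fin sum_Diff_bit [of B d] by simp
  moreover have "\<Sum>(insert y d) = \<Sum>B + \<Sum>e + \<Sum>d"
    using nin2 find de fin sum_Diff_bit [of B e] by simp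
  moreover have "\<Sum>(B - (d \<union> e)) = \<Sum>B + (\<Sum>d + \<Sum>e)"
    using find de fin sum_Diff_bit [of B "d \<union> e"] by (simp add: sum.union_disjoint)
  moreover have "card (B - (d \<union> e)) = 3"
    using find de B(2) by (simp add: card_Diff_subset card_Un_disjoint)
  moreover have "insert x e \<inter> insert y d = {}" using nin2 xy(2) de(5) by auto
  moreover have "insert x e \<inter> (B - (d \<union> e)) = {}" "insert y d \<inter> (B - (d \<union> e)) = {}"
    using nin by auto
  ultimately have "equal_sum_triples (insert x e) (insert y d) (B - (d \<union> e))"
    unfolding equal_sum_triples_def using nin2 find de(3,4)
    by (simp only: card_insert_disjoint) (simp add: add.commute add.left_commute)
  moreover have "C = insert x e \<union> insert y d \<union> (B - (d \<union> e))"
    using Ceq de by auto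
  ultimately show ?thesis using that by metis
qed

lemma equal_sum_triples_finite:
  assumes "equal_sum_triples U V W"
  shows "finite U" "finite V" "finite W"
  using assms unfolding equal_sum_triples_def by (metis card.infinite zero_neq_numeral)+

text \<open>Equating the sums of \<open>U\<close> and \<open>W\<close> and solving for
  \<open>x\<close> gives a sum of 2 + 3 = 5 points.\<close>

lemma equal_sum_triples_mem_aff:
  assumes T: "equal_sum_triples U V W" and "x \<in> U"
  shows "x \<in> aff ((U - {x}) \<union> W)"
proof -
  note fin = equal_sum_triples_finite [OF T]
  have disj: "(U - {x}) \<inter> W = {}" using T unfolding equal_sum_triples_def by auto
  have "\<Sum>((U - {x}) \<union> W) = \<Sum>(U - {x}) + \<Sum>W"
    using fin disj by (intro sum.union_disjoint) auto
  also have "\<Sum>W = \<Sum>U" using T unfolding equal_sum_triples_def by auto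
  also have "\<dots> = x + \<Sum>(U - {x})" using fin assms(2) by (simp add: sum.remove)
  also have "\<Sum>(U - {x}) + \<dots> = x" by (metis add.commute bitfun_add_left_self)
  finally have "x = \<Sum>((U - {x}) \<union> W)" by simp
  moreover have "card ((U - {x}) \<union> W) = 5"
    using fin disj assms(2) T unfolding equal_sum_triples_def by (simp add: card_Un_disjoint)
  ultimately show ?thesis
    using mem_affI [of "(U - {x}) \<union> W" "(U - {x}) \<union> W"] fin by simp
qed

lemma equal_sum_triples_swap:
  "equal_sum_triples U V W \<Longrightarrow> equal_sum_triples V U W"
  "equal_sum_triples U V W \<Longrightarrow> equal_sum_triples U W V"
  unfolding equal_sum_triples_def by auto

text \<open>The triple \<open>W\<close> stays intact, so \<open>x\<close> is recovered from
  \<open>W\<close> and the rest of \<open>U\<close>, and \<open>y\<close> from \<open>W\<close> and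
  the rest of \<open>V\<close>.\<close>

lemma cap_dim_remove_across:
  assumes T: "equal_sum_triples U V W" and xy: "x \<in> U" "y \<in> V"
  shows "cap_dim (U \<union> V \<union> W - {x, y}) = cap_dim (U \<union> V \<union> W)"
proof (rule sym, rule cap_dim_eq_if_subset_aff)
  let ?C = "U \<union> V \<union> W - {x, y}"
  have disj: "U \<inter> V = {}" "U \<inter> W = {}" "V \<inter> W = {}"
    using T unfolding equal_sum_triples_def by auto
  have "x \<in> aff ?C"
    by (rule subsetD [OF aff_mono equal_sum_triples_mem_aff [OF T xy(1)]]) (use disj xy in auto)
  moreover have "y \<in> aff ?C"
    by (rule subsetD [OF aff_mono equal_sum_triples_mem_aff [OF equal_sum_triples_swap(1) [OF T] xy(2)]])
      (use disj xy in auto)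
  ultimately show "U \<union> V \<union> W \<subseteq> aff ?C" using subset_aff [of ?C] by auto
  have "W \<noteq> {}" using T unfolding equal_sum_triples_def by auto
  then show "?C \<noteq> {}" using disj xy by auto
qed auto

text \<open>The dependence \<open>V \<union> W\<close> survives, while 7 points of dimension 6 would
  be affinely independent.\<close>

lemma cap_dim_remove_within:
  assumes T: "equal_sum_triples U V W" and xy: "x \<in> U" "y \<in> U" "x \<noteq> y"
  shows "cap_dim (U \<union> V \<union> W - {x, y}) \<noteq> 6"
proof
  let ?C = "U \<union> V \<union> W - {x, y}"
  assume d: "cap_dim ?C = 6"
  note fin = equal_sum_triples_finite [OF T]
  have disj: "U \<inter> V = {}" "U \<inter> W = {}" "V \<inter> W = {}" and c: "card U = 3" "card V = 3" "card W = 3"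
    and s: "\<Sum>V = \<Sum>W"
    using T unfolding equal_sum_triples_def by auto
  have cVW: "card (V \<union> W) = 6" using fin disj c by (simp add: card_Un_disjoint)
  have "card (U \<union> (V \<union> W)) = 9"
    using fin disj c cVW by (subst card_Un_disjoint) auto
  then have "card ?C = 7" using fin xy by (simp add: card_Diff_subset Un_assoc)
  then have "aff_indep ?C" using d fin by (intro aff_indep_if_card) auto
  moreover have "V \<union> W \<subseteq> ?C" using disj xy by auto
  moreover have "\<Sum>(V \<union> W) = 0" using fin disj s by (simp add: sum.union_disjoint)
  ultimately have "V \<union> W = {}" using cVW fin unfolding aff_indep_def
    by (metis even_numeral finite_UnI)
  then show False using cVW by simp
qed

lemma card_removals:
  assumes C: "cap n C" "card C = 9" "cap_dim C = 6"
  shows "card {(x, y). x \<in> C \<and> y \<in> C \<and> x \<noteq> y \<and> cap_dim (C - {x, y}) = 6} = 54"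
    (is "card ?R = _")
proof -
  obtain U V W where Ceq: "C = U \<union> V \<union> W" and T: "equal_sum_triples U V W"
    using cap_triples [OF C] .
  note fin = equal_sum_triples_finite [OF T]
  have disj: "U \<inter> V = {}" "U \<inter> W = {}" "V \<inter> W = {}" and c: "card U = 3" "card V = 3" "card W = 3"
    using T unfolding equal_sum_triples_def by auto
  \<comment> \<open>The two transpositions generate all six orders of the triples, so the lemmas
    apply to every choice of triples for \<open>x\<close> and \<open>y\<close>.\<close>
  note T' = T equal_sum_triples_swap(1) [OF T] equal_sum_triples_swap(2) [OF T]
    equal_sum_triples_swap(2) [OF equal_sum_triples_swap(1) [OF T]]
    equal_sum_triples_swap(1) [OF equal_sum_triples_swap(2) [OF T]]
    equal_sum_triples_swap(1) [OF equal_sum_triples_swap(2) [OF equal_sum_triples_swap(1) [OF T]]]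
  have eqs: "V \<union> U \<union> W = C" "U \<union> W \<union> V = C" "V \<union> W \<union> U = C" "W \<union> U \<union> V = C" "W \<union> V \<union> U = C" "U \<union> V \<union> W = C"
    using Ceq by auto
  have across: "cap_dim (C - {x, y}) = 6"
    if "x \<in> U \<and> y \<in> V \<or> x \<in> U \<and> y \<in> W \<or> x \<in> V \<and> y \<in> U \<or> x \<in> V \<and> y \<in> W \<or>
      x \<in> W \<and> y \<in> U \<or> x \<in> W \<and> y \<in> V" for x y
    using that T'[THEN cap_dim_remove_across, unfolded eqs C(3)] by blast
  have within: "cap_dim (C - {x, y}) \<noteq> 6"
    if "x \<in> U \<and> y \<in> U \<or> x \<in> V \<and> y \<in> V \<or> x \<in> W \<and> y \<in> W" "x \<noteq> y" for x y
    using that T'[THEN cap_dim_remove_within, unfolded eqs] by blast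
  have "?R = U \<times> (V \<union> W) \<union> (V \<times> (U \<union> W) \<union> W \<times> (U \<union> V))" (is "_ = ?S")
  proof (intro equalityI subsetI)
    fix p assume "p \<in> ?R"
    then obtain x y where p: "p = (x, y)" and xy: "x \<in> C" "y \<in> C" "x \<noteq> y" "cap_dim (C - {x, y}) = 6"
      by auto
    then show "p \<in> ?S"
      using within [of x y] unfolding Ceq p by blast
  next
    fix p assume "p \<in> ?S"
    then obtain x y where p: "p = (x, y)" and
      xy: "x \<in> U \<and> y \<in> V \<or> x \<in> U \<and> y \<in> W \<or> x \<in> V \<and> y \<in> U \<or> x \<in> V \<and> y \<in> W \<or>
      x \<in> W \<and> y \<in> U \<or> x \<in> W \<and> y \<in> V" by blast
    have "x \<in> C" "y \<in> C" "x \<noteq> y" using xy disj unfolding Ceq by blast+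
    then show "p \<in> ?R" using across [OF xy] unfolding p by simp
  qed
  \<comment> \<open>Each 18 is 3 * 6: \<open>x\<close> in one triple, \<open>y\<close> in the other
    two.\<close>
  also have "card \<dots> = 18 + (18 + 18)"
  proof -
    have u: "card (V \<union> W) = 6" "card (U \<union> W) = 6" "card (U \<union> V) = 6"
      using fin disj c by (simp_all add: card_Un_disjoint)
    have "card (V \<times> (U \<union> W) \<union> W \<times> (U \<union> V)) = 18 + 18"
      using fin disj c u by (subst card_Un_disjoint) (auto simp: card_cartesian_product)
    then show ?thesis
      using fin disj c u by (subst card_Un_disjoint) (auto simp: card_cartesian_product)
  qed
  finally show ?thesis by simp
qed

section \<open>The double count\<close>

lemma Q_double_count: "54 * Q 6 9 n = 210 * Q 6 7 n"
proof -
  define X where "X = {B. cap n B \<and> card B = 7 \<and> cap_dim B = int 6}"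
  define Y where "Y = {C. cap n C \<and> card C = 9 \<and> cap_dim C = int 6}"
  define E where "E B = {(x, y). x \<notin> B \<and> y \<notin> B \<and> x \<noteq> y \<and> cap n (insert x (insert y B)) \<and>
    cap_dim (insert x (insert y B)) = 6}" for B
  define R where "R C = {(x, y). x \<in> C \<and> y \<in> C \<and> x \<noteq> y \<and> cap_dim (C - {x, y}) = 6}"
    for C :: "(nat \<Rightarrow> bit) set"
  have "X \<subseteq> Pow (Z2 n)" "Y \<subseteq> Pow (Z2 n)" by (auto simp: X_def Y_def cap_def)
  then have fin: "finite X" "finite Y" using finite_Z2 finite_subset by blast+
  have E: "card (E B) = 210" if "B \<in> X" for B
    using card_extensions [of B n] that by (simp add: E_def X_def cap_def)
  have R: "card (R C) = 54" if "C \<in> Y" for C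
    using card_removals [of n C] that by (simp add: R_def Y_def)
  \<comment> \<open>An infinite set would have \<open>card\<close> 0, so the nonzero counts already
    give finiteness.\<close>
  have finE: "\<forall>B\<in>X. finite (E B)"
    using E by (metis card.infinite zero_neq_numeral)
  have finR: "\<forall>C\<in>Y. finite (R C)"
    using R by (metis card.infinite zero_neq_numeral)
  let ?f = "\<lambda>(B, x, y). (insert x (insert y B), x, y)"
  let ?g = "\<lambda>(C, x, y). (C - {x, y}, x, y)"
  \<comment> \<open>Inserting and deleting the marked points \<open>x\<close> and \<open>y\<close>
    are mutually inverse, since the points are kept as part of the triple.\<close>
  have "bij_betw ?f (Sigma X E) (Sigma Y R)"
  proof (rule bij_betw_byWitness [where f' = ?g])
    show "\<forall>p\<in>Sigma X E. ?g (?f p) = p" by (auto simp: E_def)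
    show "\<forall>p\<in>Sigma Y R. ?f (?g p) = p" by (auto simp: R_def)
    show "?f ` Sigma X E \<subseteq> Sigma Y R"
    proof clarify
      fix B x y assume B: "B \<in> X" and "(x, y) \<in> E B"
      then have xy: "x \<notin> B" "y \<notin> B" "x \<noteq> y" "cap n (insert x (insert y B))"
        "cap_dim (insert x (insert y B)) = 6" by (auto simp: E_def)
      have "finite B" using B by (auto simp: X_def intro: card_ge_0_finite)
      moreover have "insert x (insert y B) - {x, y} = B" using xy by auto
      ultimately show "insert x (insert y B) \<in> Y \<and> (x, y) \<in> R (insert x (insert y B))"
        using B xy by (simp add: X_def Y_def R_def)
    qed
    show "?g ` Sigma Y R \<subseteq> Sigma X E"
    proof clarify
      fix C x y assume C: "C \<in> Y" and "(x, y) \<in> R C"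
      then have xy: "x \<in> C" "y \<in> C" "x \<noteq> y" "cap_dim (C - {x, y}) = 6" by (auto simp: R_def)
      have "card (C - {x, y}) = 7"
        using C xy by (simp add: Y_def card_Diff_subset)
      moreover have "cap n (C - {x, y})" using C unfolding Y_def cap_def by blast
      moreover have "insert x (insert y (C - {x, y})) = C" using xy by auto
      ultimately show "C - {x, y} \<in> X \<and> (x, y) \<in> E (C - {x, y})"
        using C xy by (simp add: X_def Y_def E_def)
    qed
  qed
  then have "card (Sigma X E) = card (Sigma Y R)" by (rule bij_betw_same_card)
  then have "(\<Sum>B\<in>X. card (E B)) = (\<Sum>C\<in>Y. card (R C))"
    using fin finE finR by (simp add: card_SigmaI)
  then have "card X * 210 = card Y * 54" using E R by simp
  then show ?thesis by (simp add: Q_def X_def Y_def)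
qed

theorem theorem7p6:
  fixes n :: nat
  shows "real (Q 6 9 n) = 35 / 9 * real (Q 6 7 n)"
proof -
  have "54 * real (Q 6 9 n) = 210 * real (Q 6 7 n)"
    using Q_double_count [of n] by (metis of_nat_mult of_nat_numeral)
  then show ?thesis by simp
qed

end
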